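(* Let $V:\mathbb R^n\times\mathbb R^l\to\mathbb R$ be a reference-dependent Lyapunov function for the prestabilized system $\dot{\bm x}=f_\pi(\bm x,\bm v)$ such that $\frac{\partial V}{\partial\bm x}(\bm x,\bm v)\neq0$ for every $\bm v\in\mathbb R^l$ and $\bm x\in\mathcal D_{\bm v}\setminus\{\bar x(\bm v)\}$, let $\epsilon\in(0,1)$, and let $\Delta:\tilde{\mathcal D}\to\mathbb R^2$ be a Lyapunov-based dynamic safety margin, i.e. a DSM of the form $$\Delta(\bm x,\bm v)=\begin{bmatrix}\Gamma^*(\bm v)-V(\bm x,\bm v)\\ (1-\epsilon)\overline\Gamma(\bm v)-V(\bm x,\bm v)\end{bmatrix}.$$ Then for every class $\mathscr K$ function $\alpha$ and every $(\bm x,\bm v)\in\tilde{\mathcal C}$, $\tilde{\mathcal K}_\alpha(\bm x,\bm v)\neq\emptyset$.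
   Context: Class $\mathscr K$: continuous strictly increasing $\alpha:[0,\infty)\to[0,\infty)$ with $\alpha(0)=0$. System: $\dot{\bm x}=f(\bm x)+g(\bm x)\bm u$, with $f:\mathbb R^n\to\mathbb R^n$ and $g:\mathbb R^n\to\mathbb R^{n\times m}$ locally Lipschitz, subject to $\bm x\in\mathcal X$, $\bm u\in\mathcal U$, where $\mathcal X\subset\mathbb R^n$ and $\mathcal U\subset\mathbb R^m$ are closed. Equilibria: there is a simply connected manifold of stabilizable equilibria parameterized by continuous $\bar x:\mathbb R^l\to\mathbb R^n$, $\bar u:\mathbb R^l\to\mathbb R^m$ with $f(\bar x(\bm v))+g(\bar x(\bm v))\bar u(\bm v)=0$ for all $\bm v\in\mathbb R^l$. The set of steady-state admissible references $\mathcal V=\{\bm v\in\mathbb R^l\mid \bar x(\bm v)\in\mathcal X,\ \bar u(\bm v)\in\mathcal U\}$ is assumed nonempty. Prestabilizing controller: $\pi:\mathbb R^n\times\mathbb R^l\to\mathbb R^m$ is jointly continuous and locally Lipschitz in its first argument, $\pi(\bar x(\bm v),\bm v)=\bar u(\bm v)$, and for each fixed $\bm v$ the point $\bar x(\bm v)$ is an asymptotically stable equilibrium of $\dot{\bm x}=f_\pi(\bm x,\bm v):=f(\bm x)+g(\bm x)\pi(\bm x,\bm v)$. For each $\bm v$, $\mathcal D_{\bm v}\subset\mathbb R^n$ is an open set containing $\bar x(\bm v)$ such that solutions of $\dot{\bm x}=f_\pi(\bm x,\bm v)$ starting in $\mathcal D_{\bm v}$ converge to $\bar x(\bm v)$.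 The set $\tilde{\mathcal D}=\{(\bm x,\bm v)\in\mathbb R^n\times\mathbb R^l\mid \bm x\in\mathcal D_{\bm v}\}$ is assumed open in $\mathbb R^n\times\mathbb R^l$. Constraint sets: $\mathcal X_{\bm v}=\{\bm x\in\mathcal X\mid \pi(\bm x,\bm v)\in\mathcal U\}$, $\mathcal X^c_{\bm v}=\mathbb R^n\setminus\mathcal X_{\bm v}$, and $\tilde{\mathcal X}=\{(\bm x,\bm v)\in\mathbb R^n\times\mathbb R^l\mid \bm x\in\mathcal X_{\bm v},\ \bm v\in\mathcal V\}$. DSM: a continuously differentiable $\Delta:\tilde{\mathcal D}\to\mathbb R^{n_c}$ with components $\Delta_i$ is a dynamic safety margin if, with $\tilde{\mathcal C}=\{(\bm x,\bm v)\in\tilde{\mathcal D}\mid \Delta(\bm x,\bm v)\ge 0\}$ (componentwise inequality): (i) $\tilde{\mathcal C}\subset\tilde{\mathcal X}$; (ii) $\tilde{\mathcal C}$ is compact in $\mathbb R^n\times\mathbb R^l$; (iii) for every $i\in\{1,\dots,n_c\}$ and $(\bm x,\bm v)\in\tilde{\mathcal D}$, $\Delta_i(\bm x,\bm v)=0$ implies $\frac{\partial\Delta_i}{\partial\bm x}(\bm x,\bm v)f_\pi(\bm x,\bm v)\ge 0$. Reference-dependent Lyapunov function: a continuously differentiable $V:\mathbb R^n\times\mathbb R^l\to\mathbb R$ for which there exist $\gamma_1,\gamma_2\in\mathscr K$ such that for every $\bm v\in\mathbb R^l$ and every $\bm x\in\mathcal D_{\bm v}$ (the open set containing $\bar x(\bm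 v)$ from which solutions of $\dot{\bm x}=f_\pi(\bm x,\bm v)$ converge to $\bar x(\bm v)$), $\gamma_1(\|\bm x-\bar x(\bm v)\|)\le V(\bm x,\bm v)\le\gamma_2(\|\bm x-\bar x(\bm v)\|)$ and $\frac{\partial V}{\partial\bm x}(\bm x,\bm v)f_\pi(\bm x,\bm v)\le 0$. Threshold values (assumed real-valued and continuously differentiable): $\Gamma^*(\bm v)=\inf_{\bm x\in\mathcal X^c_{\bm v}\cap\mathcal D_{\bm v}}V(\bm x,\bm v)-\inf_{\bm x\in\mathcal X_{\bm v}\cap\mathcal D_{\bm v}}V(\bm x,\bm v)$ and $\overline\Gamma(\bm v)=\inf_{\bm x\in\partial\mathcal D_{\bm v}}V(\bm x,\bm v)$. Viable inputs: $\tilde{\mathcal K}_\alpha(\bm x,\bm v)$ is the set of $(\bm u,\bm w)\in\mathcal U\times\mathbb R^l$ with $\min_{i}\big[\dot\Delta_i(\bm x,\bm v,\bm u,\bm w)+\alpha(\Delta_i(\bm x,\bm v))\big]\ge 0$, where $\dot\Delta_i(\bm x,\bm v,\bm u,\bm w)=\frac{\partial\Delta_i}{\partial\bm x}(\bm x,\bm v)(f(\bm x)+g(\bm x)\bm u)+\frac{\partial\Delta_i}{\partial\bm v}(\bm x,\bm v)\bm w$. *)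

theory Defs
  imports "HOL-Analysis.Analysis"
begin

text \<open>Only the values on \<open>{0..}\<close> matter; that they lie in \<open>{0..}\<close> follows from
  monotonicity and \<open>\<alpha> 0 = 0\<close>.\<close>

definition class_K :: "(real \<Rightarrow> real) set" where
  "class_K = {\<alpha>. continuous_on {0..} \<alpha> \<and> strict_mono_on {0..} \<alpha> \<and> \<alpha> 0 = 0}"

text \<open>Intended for open \<open>S\<close>.\<close>

definition C1_on :: "'a::real_normed_vector set \<Rightarrow> ('a \<Rightarrow> 'b::real_normed_vector) \<Rightarrow> bool" where
  "C1_on S h \<longleftrightarrow> (\<exists>h' :: 'a \<Rightarrow> 'a \<Rightarrow>\<^sub>L 'b.
     (\<forall>x\<in>S. (h has_derivative blinfun_apply (h' x)) (at x)) \<and> continuous_on S h')"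

text \<open>The library notion for time-dependent functions, applied to a time-independent one.\<close>

definition locally_lipschitz :: "('a::metric_space \<Rightarrow> 'b::metric_space) \<Rightarrow> bool" where
  "locally_lipschitz h \<longleftrightarrow> local_lipschitz (UNIV :: real set) UNIV (\<lambda>_. h)"

text \<open>Hausdorff and second countable come for free for subsets of a Euclidean space. The model
  space \<open>T\<close> may be taken inside the ambient space, since a manifold embedded there cannot have a
  larger dimension.\<close>

definition topological_manifold :: "'a::euclidean_space set \<Rightarrow> bool" where
  "topological_manifold M \<longleftrightarrow> (\<exists>T :: 'a set. subspace T \<and>
     (\<forall>p\<in>M. \<exists>N W. p \<in> N \<and> openin (top_of_set M) N \<and> openin (top_of_set T) W \<and> N homeomorphic W))"

definition partial_fst ::
  "('a::real_normed_vector \<times> 'b \<Rightarrow> 'c::real_normed_vector) \<Rightarrow> 'a \<Rightarrow> 'b \<Rightarrow> 'a \<Rightarrow> 'c" where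
  "partial_fst h x v = frechet_derivative (\<lambda>y. h (y, v)) (at x)"

definition partial_snd ::
  "('a \<times> 'b::real_normed_vector \<Rightarrow> 'c::real_normed_vector) \<Rightarrow> 'a \<Rightarrow> 'b \<Rightarrow> 'b \<Rightarrow> 'c" where
  "partial_snd h x v = frechet_derivative (\<lambda>z. h (x, z)) (at v)"

definition global_solution ::
  "('a::real_normed_vector \<Rightarrow> 'a) \<Rightarrow> 'a \<Rightarrow> (real \<Rightarrow> 'a) \<Rightarrow> bool" where
  "global_solution F x0 \<phi> \<longleftrightarrow>
     \<phi> 0 = x0 \<and> (\<forall>t\<ge>0. (\<phi> has_vector_derivative F (\<phi> t)) (at t within {0..}))"

text \<open>The existence conjuncts below exclude finite escape time.\<close>

definition converges_from :: "('a::real_normed_vector \<Rightarrow> 'a) \<Rightarrow> 'a \<Rightarrow> 'a \<Rightarrow> bool" where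
  "converges_from F x0 p \<longleftrightarrow>
     (\<exists>\<phi>. global_solution F x0 \<phi>) \<and>
     (\<forall>\<phi>. global_solution F x0 \<phi> \<longrightarrow> (\<phi> \<longlongrightarrow> p) at_top)"

definition asymptotically_stable :: "('a::real_normed_vector \<Rightarrow> 'a) \<Rightarrow> 'a \<Rightarrow> bool" where
  "asymptotically_stable F p \<longleftrightarrow>
     F p = 0 \<and>
     (\<forall>e>0. \<exists>d>0. \<forall>x0\<in>ball p d.
        (\<exists>\<phi>. global_solution F x0 \<phi>) \<and>
        (\<forall>\<phi>. global_solution F x0 \<phi> \<longrightarrow> (\<forall>t\<ge>0. \<phi> t \<in> ball p e))) \<and>
     (\<exists>d>0. \<forall>x0\<in>ball p d. converges_from F x0 p)"

definition closed_loop ::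
  "(real^'n \<Rightarrow> real^'n) \<Rightarrow> (real^'n \<Rightarrow> real^'m^'n) \<Rightarrow> ((real^'n) \<times> (real^'l) \<Rightarrow> real^'m)
    \<Rightarrow> real^'n \<Rightarrow> real^'l \<Rightarrow> real^'n" where
  "closed_loop f g \<pi> x v = f x + g x *v \<pi> (x, v)"

definition admissible_refs ::
  "(real^'n) set \<Rightarrow> (real^'m) set \<Rightarrow> (real^'l \<Rightarrow> real^'n) \<Rightarrow> (real^'l \<Rightarrow> real^'m)
    \<Rightarrow> (real^'l) set" where
  "admissible_refs X U xbar ubar = {v. xbar v \<in> X \<and> ubar v \<in> U}"

definition admissible_states ::
  "(real^'n) set \<Rightarrow> (real^'m) set \<Rightarrow> ((real^'n) \<times> (real^'l) \<Rightarrow> real^'m) \<Rightarrow> real^'l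
    \<Rightarrow> (real^'n) set" where
  "admissible_states X U \<pi> v = {x \<in> X. \<pi> (x, v) \<in> U}"

definition admissible_pairs ::
  "(real^'n) set \<Rightarrow> (real^'m) set \<Rightarrow> (real^'l \<Rightarrow> real^'n) \<Rightarrow> (real^'l \<Rightarrow> real^'m)
    \<Rightarrow> ((real^'n) \<times> (real^'l) \<Rightarrow> real^'m) \<Rightarrow> ((real^'n) \<times> (real^'l)) set" where
  "admissible_pairs X U xbar ubar \<pi> =
     {(x, v). x \<in> admissible_states X U \<pi> v \<and> v \<in> admissible_refs X U xbar ubar}"

definition basin_graph :: "(real^'l \<Rightarrow> (real^'n) set) \<Rightarrow> ((real^'n) \<times> (real^'l)) set" where
  "basin_graph D = {(x, v). x \<in> D v}"

definition safe_set ::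
  "(real^'l \<Rightarrow> (real^'n) set) \<Rightarrow> ((real^'n) \<times> (real^'l) \<Rightarrow> real^'c) \<Rightarrow> ((real^'n) \<times> (real^'l)) set" where
  "safe_set D \<Delta> = {p \<in> basin_graph D. \<forall>i. \<Delta> p $ i \<ge> 0}"

text \<open>The values of \<open>\<Delta>\<close> outside the open set \<open>basin_graph D\<close> are irrelevant.\<close>

definition dynamic_safety_margin ::
  "(real^'n \<Rightarrow> real^'n) \<Rightarrow> (real^'n \<Rightarrow> real^'m^'n) \<Rightarrow> (real^'n) set \<Rightarrow> (real^'m) set
    \<Rightarrow> (real^'l \<Rightarrow> real^'n) \<Rightarrow> (real^'l \<Rightarrow> real^'m) \<Rightarrow> ((real^'n) \<times> (real^'l) \<Rightarrow> real^'m)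
    \<Rightarrow> (real^'l \<Rightarrow> (real^'n) set) \<Rightarrow> ((real^'n) \<times> (real^'l) \<Rightarrow> real^'c) \<Rightarrow> bool" where
  "dynamic_safety_margin f g X U xbar ubar \<pi> D \<Delta> \<longleftrightarrow>
     C1_on (basin_graph D) \<Delta> \<and>
     safe_set D \<Delta> \<subseteq> admissible_pairs X U xbar ubar \<pi> \<and>
     compact (safe_set D \<Delta>) \<and>
     (\<forall>i x v. (x, v) \<in> basin_graph D \<longrightarrow> \<Delta> (x, v) $ i = 0 \<longrightarrow>
        partial_fst (\<lambda>p. \<Delta> p $ i) x v (closed_loop f g \<pi> x v) \<ge> 0)"

definition reference_dependent_lyapunov ::
  "(real^'n \<Rightarrow> real^'n) \<Rightarrow> (real^'n \<Rightarrow> real^'m^'n) \<Rightarrow> (real^'l \<Rightarrow> real^'n)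
    \<Rightarrow> ((real^'n) \<times> (real^'l) \<Rightarrow> real^'m) \<Rightarrow> (real^'l \<Rightarrow> (real^'n) set)
    \<Rightarrow> ((real^'n) \<times> (real^'l) \<Rightarrow> real) \<Rightarrow> bool" where
  "reference_dependent_lyapunov f g xbar \<pi> D V \<longleftrightarrow>
     C1_on UNIV V \<and>
     (\<exists>\<gamma>1\<in>class_K. \<exists>\<gamma>2\<in>class_K. \<forall>v. \<forall>x\<in>D v.
        \<gamma>1 (norm (x - xbar v)) \<le> V (x, v) \<and>
        V (x, v) \<le> \<gamma>2 (norm (x - xbar v)) \<and>
        partial_fst V x v (closed_loop f g \<pi> x v) \<le> 0)"

text \<open>Infima are taken in the extended reals, so that finiteness is a genuine condition (an
  infimum over the empty set is \<open>\<infinity>\<close>). A difference of extended reals is finite exactly when both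
  terms are.\<close>

definition Gamma_star ::
  "(real^'n) set \<Rightarrow> (real^'m) set \<Rightarrow> ((real^'n) \<times> (real^'l) \<Rightarrow> real^'m)
    \<Rightarrow> (real^'l \<Rightarrow> (real^'n) set) \<Rightarrow> ((real^'n) \<times> (real^'l) \<Rightarrow> real) \<Rightarrow> real^'l \<Rightarrow> ereal" where
  "Gamma_star X U \<pi> D V v =
     (INF x\<in>(- admissible_states X U \<pi> v) \<inter> D v. ereal (V (x, v))) -
     (INF x\<in>admissible_states X U \<pi> v \<inter> D v. ereal (V (x, v)))"

definition Gamma_bar ::
  "(real^'l \<Rightarrow> (real^'n) set) \<Rightarrow> ((real^'n) \<times> (real^'l) \<Rightarrow> real) \<Rightarrow> real^'l \<Rightarrow> ereal" where
  "Gamma_bar D V v = (INF x\<in>frontier (D v). ereal (V (x, v)))"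

definition margin_rate ::
  "(real^'n \<Rightarrow> real^'n) \<Rightarrow> (real^'n \<Rightarrow> real^'m^'n) \<Rightarrow> ((real^'n) \<times> (real^'l) \<Rightarrow> real^'c)
    \<Rightarrow> 'c \<Rightarrow> real^'n \<Rightarrow> real^'l \<Rightarrow> real^'m \<Rightarrow> real^'l \<Rightarrow> real" where
  "margin_rate f g \<Delta> i x v u w =
     partial_fst (\<lambda>p. \<Delta> p $ i) x v (f x + g x *v u) + partial_snd (\<lambda>p. \<Delta> p $ i) x v w"

definition viable_inputs ::
  "(real^'n \<Rightarrow> real^'n) \<Rightarrow> (real^'n \<Rightarrow> real^'m^'n) \<Rightarrow> (real^'m) set
    \<Rightarrow> ((real^'n) \<times> (real^'l) \<Rightarrow> real^'c::finite) \<Rightarrow> (real \<Rightarrow> real) \<Rightarrow> real^'n \<Rightarrow> real^'l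
    \<Rightarrow> ((real^'m) \<times> (real^'l)) set" where
  "viable_inputs f g U \<Delta> \<alpha> x v =
     {(u, w). u \<in> U \<and> (MIN i. margin_rate f g \<Delta> i x v u w + \<alpha> (\<Delta> (x, v) $ i)) \<ge> 0}"

end

theory Submission
  imports Defs
begin

text \<open>The reference can be frozen. With \<open>u = \<pi> (x, v)\<close> and \<open>w = 0\<close> each margin changes at rate
  \<open>- \<partial>V/\<partial>x \<cdot> f\<^sub>\<pi>\<close>, which is nonnegative because \<open>V\<close> is a Lyapunov function, and
  \<open>\<alpha> (\<Delta>\<^sub>i)\<close> is nonnegative on the safe set.\<close>

lemma class_K_nonneg:
  assumes "\<alpha> \<in> class_K" "0 \<le> r"
  shows "0 \<le> \<alpha> r"
proof (cases "r = 0")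
  case False
  have "strict_mono_on {0..} \<alpha>" and "\<alpha> 0 = 0"
    using assms(1) by (auto simp: class_K_def)
  then show ?thesis
    using False assms(2) strict_mono_onD[of "{0..}" \<alpha> 0 r] by simp
qed (use assms in \<open>simp add: class_K_def\<close>)

text \<open>Chain rule through the slice map. It passes from joint differentiability, which is what
  \<open>C1_on\<close> supplies, to the slice derivative in \<open>partial_fst\<close>.\<close>

lemma has_derivative_partial_fst:
  assumes "(h has_derivative h') (at (x, v))"
  shows "((\<lambda>y. h (y, v)) has_derivative (\<lambda>d. h' (d, 0))) (at x)"
proof -
  have "((\<lambda>y. (y, v)) has_derivative (\<lambda>d. (d, 0))) (at x)"
    by (auto intro!: derivative_eq_intros)
  from has_derivative_compose[OF this] assms show ?thesis by auto
qed

lemma has_derivative_partial_snd: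
  assumes "(h has_derivative h') (at (x, v))"
  shows "((\<lambda>z. h (x, z)) has_derivative (\<lambda>d. h' (0, d))) (at v)"
proof -
  have "((\<lambda>z. (x, z)) has_derivative (\<lambda>d. (0, d))) (at v)"
    by (auto intro!: derivative_eq_intros)
  from has_derivative_compose[OF this] assms show ?thesis by auto
qed

text \<open>A derivative is linear, so it sends 0 to 0. Differentiability has to be assumed:
  \<open>frechet_derivative\<close> is a choice, with unspecified value where no derivative
  exists.\<close>

lemma partial_snd_zero:
  assumes "(h has_derivative h') (at (x, v))"
  shows "partial_snd h x v 0 = 0"
  using frechet_derivative_at[OF has_derivative_partial_snd[OF assms]]
    linear_0[OF has_derivative_linear[OF assms]]
  by (metis partial_snd_def zero_prod_def)

text \<open>With \<open>v\<close> frozen, a threshold depending on \<open>v\<close> is a constant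
  and contributes no derivative. The formula for \<open>h\<close> is required only on an open set,
  since a margin has its prescribed form only over the basin.\<close>

lemma partial_fst_of_const_diff:
  assumes V: "(V has_derivative V') (at (x, v))"
    and S: "open S" "x \<in> S"
    and eq: "\<And>y. y \<in> S \<Longrightarrow> h (y, v) = c - V (y, v)"
  shows "partial_fst h x v d = - partial_fst V x v d"
proof -
  note Vx = has_derivative_partial_fst[OF V]
  have "((\<lambda>y. c - V (y, v)) has_derivative (\<lambda>d. - V' (d, 0))) (at x)"
    using has_derivative_diff[OF has_derivative_const Vx, of c] by simp
  then have "((\<lambda>y. h (y, v)) has_derivative (\<lambda>d. - V' (d, 0))) (at x)"
    by (rule has_derivative_transform_within_open[OF _ S]) (simp add: eq)
  then have "frechet_derivative (\<lambda>y. h (y, v)) (at x) = (\<lambda>d. - V' (d, 0))"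
    by (rule frechet_derivative_at[symmetric])
  moreover have "frechet_derivative (\<lambda>y. V (y, v)) (at x) = (\<lambda>d. V' (d, 0))"
    using Vx by (rule frechet_derivative_at[symmetric])
  ultimately show ?thesis
    by (simp add: partial_fst_def)
qed

text \<open>Condition (i) of a margin puts \<pi>(x, v) into \<open>U\<close>, and
  \<open>w = 0\<close> removes the reference term of the rate. The premise \<open>rate\<close>
  concerns every safe point, whereas condition (iii) speaks only of zeros of the margin.\<close>

lemma viable_inputs_frozen_reference:
  assumes dsm: "dynamic_safety_margin f g X U xbar ubar \<pi> D \<Delta>"
    and safe: "(x, v) \<in> safe_set D \<Delta>"
    and \<alpha>: "\<alpha> \<in> class_K"
    and rate: "\<And>i. partial_fst (\<lambda>p. \<Delta> p $ i) x v (closed_loop f g \<pi> x v) \<ge> 0"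
  shows "(\<pi> (x, v), 0) \<in> viable_inputs f g U \<Delta> \<alpha> x v"
proof -
  have "\<pi> (x, v) \<in> U"
    using dsm safe
    by (auto simp: dynamic_safety_margin_def admissible_pairs_def admissible_states_def)
  moreover obtain \<Delta>' where "(\<Delta> has_derivative \<Delta>') (at (x, v))"
    using dsm safe unfolding dynamic_safety_margin_def C1_on_def safe_set_def by blast
  then have "((\<lambda>p. \<Delta> p $ i) has_derivative (\<lambda>d. \<Delta>' d $ i)) (at (x, v))" for i
    by (rule bounded_linear.has_derivative[OF bounded_linear_vec_nth])
  from partial_snd_zero[OF this]
  have "margin_rate f g \<Delta> i x v (\<pi> (x, v)) 0 \<ge> 0" for i
    using rate[of i] by (simp add: margin_rate_def closed_loop_def)
  moreover have "\<alpha> (\<Delta> (x, v) $ i) \<ge> 0" for i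
    using safe \<alpha> by (simp add: safe_set_def class_K_nonneg)
  \<comment> \<open>\<open>MIN i\<close> ranges over a finite nonempty index type, so its
    nonnegativity splits into one inequality per component.\<close>
  ultimately show ?thesis
    by (simp add: viable_inputs_def)
qed

theorem corollary3:
  fixes f :: "real^'n \<Rightarrow> real^'n"
    and g :: "real^'n \<Rightarrow> real^'m^'n"
    and X :: "(real^'n) set"
    and U :: "(real^'m) set"
    and xbar :: "real^'l \<Rightarrow> real^'n"
    and ubar :: "real^'l \<Rightarrow> real^'m"
    and \<pi> :: "(real^'n) \<times> (real^'l) \<Rightarrow> real^'m"
    and D :: "real^'l \<Rightarrow> (real^'n) set"
    and V :: "(real^'n) \<times> (real^'l) \<Rightarrow> real"
    and \<epsilon> :: real
    and \<Delta> :: "(real^'n) \<times> (real^'l) \<Rightarrow> real^2"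
  assumes f_lipschitz: "locally_lipschitz f"
    and g_lipschitz: "locally_lipschitz g"
    and X_closed: "closed X"
    and U_closed: "closed U"
    and xbar_cont: "continuous_on UNIV xbar"
    and ubar_cont: "continuous_on UNIV ubar"
    and equilibria: "\<forall>v. f (xbar v) + g (xbar v) *v ubar v = 0"
    and equilibria_manifold: "topological_manifold (range (\<lambda>v. (xbar v, ubar v)))"
    and equilibria_simply_connected: "simply_connected (range (\<lambda>v. (xbar v, ubar v)))"
    and refs_nonempty: "admissible_refs X U xbar ubar \<noteq> {}"
    and pi_cont: "continuous_on UNIV \<pi>"
    and pi_lipschitz: "\<forall>v. locally_lipschitz (\<lambda>x. \<pi> (x, v))"
    and pi_equilibrium: "\<forall>v. \<pi> (xbar v, v) = ubar v"
    and pi_stabilizing: "\<forall>v. asymptotically_stable (\<lambda>x. closed_loop f g \<pi> x v) (xbar v)"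
    and D_open: "\<forall>v. open (D v)"
    and D_equilibrium: "\<forall>v. xbar v \<in> D v"
    and D_converges: "\<forall>v. \<forall>x\<in>D v. converges_from (\<lambda>y. closed_loop f g \<pi> y v) x (xbar v)"
    and basin_open: "open (basin_graph D)"
    and V_lyapunov: "reference_dependent_lyapunov f g xbar \<pi> D V"
    and V_gradient: "\<forall>v. \<forall>x\<in>D v - {xbar v}. partial_fst V x v \<noteq> (\<lambda>_. 0)"
    and Gamma_star_real: "\<forall>v. \<bar>Gamma_star X U \<pi> D V v\<bar> \<noteq> \<infinity>"
    and Gamma_star_C1: "C1_on UNIV (\<lambda>v. real_of_ereal (Gamma_star X U \<pi> D V v))"
    and Gamma_bar_real: "\<forall>v. \<bar>Gamma_bar D V v\<bar> \<noteq> \<infinity>"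
    and Gamma_bar_C1: "C1_on UNIV (\<lambda>v. real_of_ereal (Gamma_bar D V v))"
    and eps: "\<epsilon> \<in> {0<..<1}"
    and Delta_dsm: "dynamic_safety_margin f g X U xbar ubar \<pi> D \<Delta>"
    and Delta_form: "\<forall>(x, v)\<in>basin_graph D. \<Delta> (x, v) =
      vector [real_of_ereal (Gamma_star X U \<pi> D V v) - V (x, v),
              (1 - \<epsilon>) * real_of_ereal (Gamma_bar D V v) - V (x, v)]"
  shows "\<forall>\<alpha>\<in>class_K. \<forall>(x, v)\<in>safe_set D \<Delta>. viable_inputs f g U \<Delta> \<alpha> x v \<noteq> {}"
proof (intro ballI, clarify)
  fix \<alpha> x v
  assume \<alpha>: "\<alpha> \<in> class_K" and safe: "(x, v) \<in> safe_set D \<Delta>"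
    and empty: "viable_inputs f g U \<Delta> \<alpha> x v = {}"
  have x: "x \<in> D v"
    using safe by (simp add: safe_set_def basin_graph_def)
  obtain V' where V': "(V has_derivative V') (at (x, v))"
    using V_lyapunov unfolding reference_dependent_lyapunov_def C1_on_def by blast
  \<comment> \<open>The Lyapunov inequality holds on all of \<open>D v\<close>, so it also covers
    points where no margin vanishes.\<close>
  have decrease: "partial_fst V x v (closed_loop f g \<pi> x v) \<le> 0"
    using V_lyapunov x unfolding reference_dependent_lyapunov_def by blast
  have "partial_fst (\<lambda>p. \<Delta> p $ i) x v (closed_loop f g \<pi> x v) \<ge> 0" for i
  proof -
    \<comment> \<open>Collecting both thresholds in one vector gives the two margins the common
      shape \<open>c $ i - V\<close>, so a single argument serves both.\<close>
    define c where "c = (vector [real_of_ereal (Gamma_star X U \<pi> D V v),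
      (1 - \<epsilon>) * real_of_ereal (Gamma_bar D V v)] :: real^2)"
    have "\<Delta> (y, v) $ i = c $ i - V (y, v)" if "y \<in> D v" for y
      using Delta_form that exhaust_2[of i] by (auto simp: basin_graph_def c_def)
    \<comment> \<open>The open set here is \<open>D v\<close>, the slice of the basin graph at
      \<open>v\<close>. The margin's rate is then minus that of \<open>V\<close>.\<close>
    then show ?thesis
      using decrease partial_fst_of_const_diff[OF V' _ x] D_open by simp
  qed
  then show False
    using viable_inputs_frozen_reference[OF Delta_dsm safe \<alpha>] empty by blast
qed

end
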